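(* Let $(P,\preceq)$ be a lattice, let $S=\{x_1,\ldots,x_n\}$ be a finite subset of $P$ with distinct elements such that $x_i\preceq x_j\Rightarrow i\leq j$, and let $f_1,\ldots,f_n:P\to\mathbb{C}$. Let $D'=\{d_1',\ldots,d_{m'}'\}$ be a finite subset of $P$ with distinct elements, containing all the elements $x_i\vee x_j$ ($i,j=1,\ldots,n$), and such that $d_i'\preceq d_j'\Rightarrow i\leq j$. Then, with the matrices $[S]_{f_1,\ldots,f_n}$, $E_{D'}'$, $\Upsilon'$ defined in the context, $$[S]_{f_1,\ldots,f_n}=\Upsilon'(E_{D'}')^T.$$
   Context: The row-adjusted join matrix $[S]_{f_1,\ldots,f_n}$ is the $n\times n$ matrix whose $ij$ entry is $f_i(x_i\vee x_j)$. For each $i=1,\ldots,n$ the function $\Psi_{D',f_i}':D'\to\mathbb{C}$ is defined inductively by $$\Psi_{D',f_i}'(d_k')=f_i(d_k')-\sum_{d_k'\prec d_v'}\Psi_{D',f_i}'(d_v'),$$ the sum being over $d_v'\in D'$; equivalently, $f_i(d_k')=\sum_{d_k'\preceq d_v'}\Psi_{D',f_i}'(d_v')$ for all $k$. $E_{D'}'$ is the $n\times m'$ matrix with entries $(e_{D'}')_{ij}=1$ if $x_i\preceq d_j'$ and $(e_{D'}')_{ij}=0$ otherwise. $\Upsilon'=(\upsilon_{ij}')$ is the $n\times m'$ matrix with $\upsilon_{ij}'=(e_{D'}')_{ij}\Psi_{D',f_i}'(d_j')$. *)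

theory Defs
  imports "HOL.Complex" "Jordan_Normal_Form.Matrix"
begin

text \<open>
  The lattice is the whole of a type of class \<open>lattice\<close>, with \<open>sup\<close> as its join. A finite indexed
  family \<open>x\<^sub>1, \<dots>, x\<^sub>n\<close> is a function on \<open>nat\<close> of which only the values at \<open>0, \<dots>, n - 1\<close> matter, so
  all indices are shifted by one to agree with the indexing of matrices.
\<close>

definition join_matrix :: "nat \<Rightarrow> (nat \<Rightarrow> 'a::lattice) \<Rightarrow> (nat \<Rightarrow> 'a \<Rightarrow> complex) \<Rightarrow> complex mat"
  where "join_matrix n x f = mat n n (\<lambda>(i, j). f i (sup (x i) (x j)))"

text \<open>
  The recursion is upwards along the order and is well-founded because \<open>D\<close> is finite; the value \<open>0\<close>
  for infinite \<open>D\<close> is a dummy. Only the values at elements of \<open>D\<close> are meaningful.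
\<close>

function Psi :: "'a::order set \<Rightarrow> ('a \<Rightarrow> complex) \<Rightarrow> 'a \<Rightarrow> complex" where
  "Psi D f d = (if finite D then f d - (\<Sum>v \<in> {v \<in> D. d < v}. Psi D f v) else 0)"
  by pat_completeness auto
termination
proof (relation "measure (\<lambda>(D, f, d). card {v \<in> D. d < v})")
  fix D :: "'a set" and f :: "'a \<Rightarrow> complex" and d v
  assume "finite D" and "v \<in> {v \<in> D. d < v}"
  then have "{w \<in> D. v < w} \<subset> {w \<in> D. d < w}"
    by auto
  then show "((D, f, v), (D, f, d)) \<in> measure (\<lambda>(D, f, d). card {v \<in> D. d < v})"
    using \<open>finite D\<close> by (simp add: psubset_card_mono)
qed simp

declare Psi.simps [simp del]

definition incidence_matrix ::
    "nat \<Rightarrow> (nat \<Rightarrow> 'a::order) \<Rightarrow> nat \<Rightarrow> (nat \<Rightarrow> 'a) \<Rightarrow> complex mat"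
  where "incidence_matrix n x m d = mat n m (\<lambda>(i, j). if x i \<le> d j then 1 else 0)"

definition Upsilon_matrix ::
    "nat \<Rightarrow> (nat \<Rightarrow> 'a::order) \<Rightarrow> nat \<Rightarrow> (nat \<Rightarrow> 'a) \<Rightarrow> (nat \<Rightarrow> 'a \<Rightarrow> complex) \<Rightarrow> complex mat"
  where "Upsilon_matrix n x m d f =
    mat n m (\<lambda>(i, j). incidence_matrix n x m d $$ (i, j) * Psi (d ` {..<m}) (f i) (d j))"

end

theory Submission
  imports Defs
begin

text \<open>This is Moebius inversion over up-sets. Entry (i, j) of the product sums
  \<open>Psi\<close> with function \<open>f i\<close> over those elements of D that lie above both
  \<open>x i\<close> and \<open>x j\<close>. By the universal property of the join, these are the
  elements above \<open>sup (x i) (x j)\<close>. Since the join itself belongs to D,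
  \<open>sum_Psi_up\<close> collapses the sum to \<open>f i\<close> at the join.\<close>

lemma sum_Psi_up:
  fixes D :: "'a::order set"
  assumes "finite D" "d \<in> D"
  shows "(\<Sum>v \<in> {v \<in> D. d \<le> v}. Psi D g v) = g d"
proof -
  \<comment> \<open>Splitting off d leaves exactly the sum that the recursion for \<open>Psi\<close>
    subtracts, so the two cancel.\<close>
  have "{v \<in> D. d \<le> v} = insert d {v \<in> D. d < v}"
    using assms(2) by (auto simp: order.order_iff_strict)
  then show ?thesis
    using assms(1) Psi.simps[of D g d] by simp
qed

theorem theorem7p1:
  fixes n m :: nat
    and x d :: "nat \<Rightarrow> 'a::lattice"
    and f :: "nat \<Rightarrow> 'a \<Rightarrow> complex"
  assumes "inj_on x {..<n}"
    and "\<And>i j. i < n \<Longrightarrow> j < n \<Longrightarrow> x i \<le> x j \<Longrightarrow> i \<le> j"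
    and "inj_on d {..<m}"
    and "\<And>i j. i < m \<Longrightarrow> j < m \<Longrightarrow> d i \<le> d j \<Longrightarrow> i \<le> j"
    and "\<And>i j. i < n \<Longrightarrow> j < n \<Longrightarrow> sup (x i) (x j) \<in> d ` {..<m}"
  shows "join_matrix n x f = Upsilon_matrix n x m d f * transpose_mat (incidence_matrix n x m d)"
proof (rule eq_matI)
  let ?U = "Upsilon_matrix n x m d f" and ?E = "incidence_matrix n x m d"
  fix i j
  assume "i < dim_row (?U * transpose_mat ?E)" "j < dim_col (?U * transpose_mat ?E)"
  then have i: "i < n" and j: "j < n"
    by (simp_all add: Upsilon_matrix_def incidence_matrix_def)
  let ?D = "d ` {..<m}" and ?s = "sup (x i) (x j)"
  \<comment> \<open>The two 0-1 factors multiply to the indicator of \<open>x i\<close> and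
    \<open>x j\<close> both lying below \<open>d k\<close>, that is, of
    \<open>?s \<le> d k\<close>.\<close>
  have "(?U * transpose_mat ?E) $$ (i, j) =
      (\<Sum>k<m. if ?s \<le> d k then Psi ?D (f i) (d k) else 0)"
    using i j
    by (auto simp: Upsilon_matrix_def incidence_matrix_def scalar_prod_def lessThan_atLeast0
        intro!: sum.cong)
  \<comment> \<open>Injectivity of d turns the sum over indices into one over the set, each element
    counted once.\<close>
  also have "\<dots> = (\<Sum>v\<in>?D. if ?s \<le> v then Psi ?D (f i) v else 0)"
    by (simp add: sum.reindex[OF assms(3)])
  also have "\<dots> = (\<Sum>v \<in> {v \<in> ?D. ?s \<le> v}. Psi ?D (f i) v)"
    by (rule sum.inter_filter[symmetric]) simp
  also have "\<dots> = f i ?s"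
    using assms(5)[OF i j] by (intro sum_Psi_up) auto
  finally show "join_matrix n x f $$ (i, j) = (?U * transpose_mat ?E) $$ (i, j)"
    using i j by (simp add: join_matrix_def)
qed (simp_all add: join_matrix_def Upsilon_matrix_def incidence_matrix_def)

end
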